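(* Let $p$ be a prime, $q=p^{r}$ ($r\in\mathbb{N}$), $k\geq 3$ an integer with $k\mid(q-1)$, $m=(q-1)/k$, $F=\mathrm{GF}(q)$, and let $\Phi$ be the unique multiplicative subgroup of order $k$ of $F^{*}$. Assume that $(q,k)$ is circular. Let $N$ be the number of solutions $(x,y,z)\in F^{3}$ of $x^{m}+y^{m}-z^{m}=1$, and $N'$ the number of those solutions with $xyz\neq 0$. (1) If $k$ is even, then \[ N=\begin{cases}3(k-1)m^{3}+6m^{2}+3m, & \text{if } 6\mid k;\\ 3(k-1)m^{3}+3m^{2}+3m, & \text{if } p=3;\\ 3(k-1)m^{3}+3m, & \text{otherwise},\end{cases} \] and $N'=3(k-1)m^{3}$. (2) If $k$ is odd, then \[ N=\begin{cases}(3k-2)m^{3}+6m^{2}+3m, & \text{if } p=2 \text{ and } 3\mid k;\\ (3k-2)m^{3}+3m, & \text{if } p=2 \text{ and } 3\nmid k;\\ (2k-1)m^{3}+3m^{2}+2m, & \text{if } 2\in\Phi;\\ (2k-1)m^{3}+2m, & \text{otherwise},\end{cases} \] and $N'=(3k-2)m^{3}$ if $p=2$, $N'=(2k-1)m^{3}$ otherwise.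
   Context: The pair $(q,k)$ (equivalently $(F,\Phi)$) is called circular if $|\Phi a\cap(\Phi b+c)|\leq 2$ for all $a,b,c\in F^{*}=F\setminus\{0\}$. *)

theory Defs
  imports
    "HOL-Algebra.Multiplicative_Group"
    "HOL-Algebra.Algebraic_Closure_Type"
begin

(* HOL-Algebra defines two identical copies of mult_of; the qualified name selects the
   one for which the theory of finite fields is developed. *)
abbreviation mult_group :: "'a::field monoid"
  where "mult_group \<equiv> Multiplicative_Group.mult_of ring_of_type_algebra"

(* The ambient field is the whole type 'a, so the pair of field and subgroup is
   determined by the subgroup alone. *)
definition circular :: "'a::field set \<Rightarrow> bool" where
  "circular \<Phi> \<longleftrightarrow>
     (\<forall>a b c. a \<noteq> 0 \<longrightarrow> b \<noteq> 0 \<longrightarrow> c \<noteq> 0 \<longrightarrow>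
        card ({x * a |x. x \<in> \<Phi>} \<inter> {x * b + c |x. x \<in> \<Phi>}) \<le> 2)"

end

theory Submission
  imports Defs
begin

text \<open>
  The map \<open>x \<mapsto> x ^ m\<close> sends the nonzero elements onto \<open>\<Phi>\<close> with all fibres of size \<open>m\<close>, so it
  suffices to solve \<open>a + b - c = 1\<close> in \<open>\<Phi> \<union> {0}\<close>. If \<open>a + b = c + d = s \<noteq> 0\<close> in \<open>\<Phi>\<close>, then
  \<open>a, b, c, d\<close> all lie in \<open>\<Phi> \<inter> (-\<Phi> + s)\<close>, and circularity forces \<open>{a, b} = {c, d}\<close>: a nonzero
  element is a sum of two elements of \<open>\<Phi>\<close> in essentially one way. Hence \<open>a + b = 1 + c\<close> has only
  the obvious solutions. For \<open>a + b = 1\<close>, the uniqueness is applied to \<open>a\<^sup>2 + a b = 1 + (-b)\<close> when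
  \<open>-1 \<in> \<Phi>\<close>, leaving the roots of \<open>a\<^sup>2 - a + 1\<close>, and to \<open>a\<^sup>2 + b = a + b\<^sup>2\<close> when \<open>-1 \<notin> \<Phi>\<close>, leaving
  \<open>a = b = 1 / 2\<close>.
\<close>

section \<open>Roots of unity, orders of elements and the characteristic\<close>

lemma card_nth_roots_le:
  fixes a :: "'a::field"
  assumes "n > 0"
  shows "card {x. x ^ n = a} \<le> n"
proof -
  let ?p = "monom 1 n - [:a:] :: 'a poly"
  have "coeff ?p n = 1"
    using assms by (cases n) auto
  then have nz: "?p \<noteq> 0"
    by (metis coeff_0 zero_neq_one)
  have "degree ?p \<le> n"
    by (intro degree_diff_le) (auto simp: degree_monom_le)
  moreover have "{x. poly ?p x = 0} = {x. x ^ n = a}"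
    by (auto simp: poly_monom)
  ultimately show ?thesis
    using card_poly_roots_bound[OF nz] by simp
qed

text \<open>Multiplication by \<open>x\<close> permutes \<open>S\<close>, so the nonzero product
  \<open>\<Prod>S\<close> absorbs the factor \<open>x ^ card S\<close>. This serves both
  \<open>\<Phi>\<close> and the set of all nonzero field elements.\<close>

lemma power_card_eq_1:
  fixes S :: "'a::field set"
  assumes "finite S" "0 \<notin> S" "x \<in> S" and mult: "\<And>y z. y \<in> S \<Longrightarrow> z \<in> S \<Longrightarrow> y * z \<in> S"
  shows "x ^ card S = 1"
proof -
  have "x \<noteq> 0"
    using assms by auto
  then have inj: "inj_on ((*) x) S"
    by (auto simp: inj_on_def)
  have "(*) x ` S = S"
    using assms by (intro card_subset_eq card_image inj) auto
  then have "\<Prod>S = (\<Prod>y\<in>S. x * y)"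
    using prod.reindex[OF inj, of id] by simp
  also have "\<dots> = x ^ card S * \<Prod>S"
    by (simp add: prod.distrib)
  finally show ?thesis
    using assms by (auto simp: prod_zero_iff)
qed

text \<open>Translation by 1 permutes the ring, so the sum of all elements absorbs
  \<open>card UNIV\<close> copies of 1.\<close>

lemma of_nat_card_UNIV_eq_0: "of_nat (card (UNIV :: 'a set)) = (0 :: 'a::{finite,ring_1})"
proof -
  have "(\<Sum>x\<in>UNIV. x :: 'a) = (\<Sum>x\<in>UNIV. x + 1)"
    by (rule sum.reindex_bij_witness[of _ "\<lambda>x. x + 1" "\<lambda>x. x - 1"]) auto
  then show ?thesis
    by (simp add: sum.distrib)
qed

text \<open>If two distinct primes vanished in the ring, Bezout would give 1 = 0. It translates 2 =
  0 and 3 = 0 in the field into conditions on \<open>p\<close>.\<close>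

lemma of_nat_prime_eq_0_iff:
  assumes "Factorial_Ring.prime (p::nat)" "Factorial_Ring.prime l" "of_nat p = (0 :: 'a::ring_1)"
  shows "of_nat l = (0 :: 'a) \<longleftrightarrow> p = l"
proof
  assume l: "of_nat l = (0 :: 'a)"
  show "p = l"
  proof (rule ccontr)
    assume "p \<noteq> l"
    then have "coprime (int p) (int l)"
      using assms primes_coprime by simp
    then obtain u v where "u * int p + v * int l = 1"
      using bezout_int[of "int p" "int l"] by auto
    then have "of_int (u * int p + v * int l) = (1 :: 'a)"
      by simp
    then show False
      using l assms by simp
  qed
qed (use assms in auto)

section \<open>Circularity and sums of two elements\<close>

lemma card_circular_le_2:
  fixes \<Phi> :: "'a::{finite,field} set"
  assumes "circular \<Phi>" "s \<noteq> 0"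
  shows "card {u \<in> \<Phi>. s - u \<in> \<Phi>} \<le> 2"
proof -
  have "{u \<in> \<Phi>. s - u \<in> \<Phi>} = {x * 1 |x. x \<in> \<Phi>} \<inter> {x * (-1) + s |x. x \<in> \<Phi>}"
  proof (intro Set.set_eqI iffI)
    fix u assume "u \<in> {u \<in> \<Phi>. s - u \<in> \<Phi>}"
    then show "u \<in> {x * 1 |x. x \<in> \<Phi>} \<inter> {x * (-1) + s |x. x \<in> \<Phi>}"
      by (auto intro!: exI[of _ "s - u"])
  qed auto
  also have "card \<dots> \<le> 2"
    using assms(1)[unfolded circular_def, rule_format, of 1 "-1" s] assms(2) by simp
  finally show ?thesis .
qed

lemma circular_sum_unique:
  fixes \<Phi> :: "'a::{finite,field} set"
  assumes circ: "circular \<Phi>" and in\<Phi>: "a \<in> \<Phi>" "b \<in> \<Phi>" "c \<in> \<Phi>" "d \<in> \<Phi>"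
    and eq: "a + b = c + d" and nz: "a + b \<noteq> 0"
  shows "a = c \<and> b = d \<or> a = d \<and> b = c"
proof (rule ccontr)
  assume contra: "\<not> ?thesis"
  let ?R = "{u \<in> \<Phi>. (a + b) - u \<in> \<Phi>}"
  have "(a + b) - c = d" "(a + b) - d = c"
    using eq by (auto simp: algebra_simps)
  then have sub: "{a, b, c, d} \<subseteq> ?R"
    using in\<Phi> by auto
  have le: "card {a, b, c, d} \<le> 2"
    using card_circular_le_2[OF circ nz] card_mono[OF _ sub] by auto
  have ne: "a \<noteq> c" "b \<noteq> c" "a \<noteq> d" "b \<noteq> d"
    using contra eq by (metis add_left_cancel add_right_cancel add.commute)+
  \<comment> \<open>Neither of \<open>a\<close>, \<open>b\<close> equals \<open>c\<close> or
    \<open>d\<close>, and only two values are available, so each pair collapses. Then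
    \<open>2 * a = 2 * c\<close> is nonzero, which excludes characteristic 2 and yields
    \<open>a = c\<close>.\<close>
  then have "a = b" "c = d"
    using le by (auto simp: card_insert_if split: if_splits)
  then have "2 * (a - c) = 0" "2 * a \<noteq> 0"
    using eq nz by (auto simp: algebra_simps)
  then show False
    using ne by auto
qed

section \<open>The group of \<open>k\<close>-th roots of unity and the fibres of the
  \<open>m\<close>-th power map\<close>

text \<open>Describing \<open>\<Phi>\<close> by an equation makes closure under products and
  quotients a computation with powers.\<close>

locale circular_roots =
  fixes \<Phi> :: "'a::{finite,field} set" and k m :: nat
  assumes \<Phi>_eq: "\<Phi> = {x. x ^ k = 1}"
    and card_\<Phi>: "card \<Phi> = k"
    and k_gt_0: "k > 0" and m_gt_0: "m > 0"
    and card_field: "card (UNIV :: 'a set) = k * m + 1"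
    and circ: "circular \<Phi>"
begin

lemma zero_notin: "0 \<notin> \<Phi>"
  using k_gt_0 by (simp add: \<Phi>_eq power_0_left)

lemma one_in: "1 \<in> \<Phi>"
  by (simp add: \<Phi>_eq)

lemma mult_in: "x \<in> \<Phi> \<Longrightarrow> y \<in> \<Phi> \<Longrightarrow> x * y \<in> \<Phi>"
  by (simp add: \<Phi>_eq power_mult_distrib)

lemma divide_in: "x \<in> \<Phi> \<Longrightarrow> y \<in> \<Phi> \<Longrightarrow> x / y \<in> \<Phi>"
  by (simp add: \<Phi>_eq power_divide)

lemma uminus_in: "-1 \<in> \<Phi> \<Longrightarrow> x \<in> \<Phi> \<Longrightarrow> - x \<in> \<Phi>"
  using mult_in[of "-1" x] by simp

lemma minus_one_in_iff: "-1 \<in> \<Phi> \<longleftrightarrow> even k \<or> (2 :: 'a) = 0"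
proof (cases "even k")
  case False
  then have "-1 \<in> \<Phi> \<longleftrightarrow> (-1 :: 'a) = 1"
    by (simp add: \<Phi>_eq)
  also have "\<dots> \<longleftrightarrow> (2 :: 'a) = 0"
    by (metis add.right_inverse one_add_one eq_neg_iff_add_eq_0)
  finally show ?thesis
    using False by simp
qed (simp add: \<Phi>_eq)

lemma power_m_in: "x \<noteq> 0 \<Longrightarrow> x ^ m \<in> \<Phi>"
  using power_card_eq_1[of "UNIV - {0}" x]
  by (simp add: \<Phi>_eq card_field card_Diff_singleton mult.commute[of k] power_mult)

text \<open>The \<open>k\<close> fibres over \<open>\<Phi>\<close> partition the
  \<open>k * m\<close> nonzero elements and each has at most \<open>m\<close> elements, so none can
  fall short.\<close>

lemma card_power_m_fibre:
  assumes "a \<in> \<Phi>"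
  shows "card {x. x ^ m = a} = m"
proof -
  have "UNIV - {0 :: 'a} = (\<Union>a\<in>\<Phi>. {x. x ^ m = a})"
    using power_m_in zero_notin m_gt_0 by (auto simp: power_0_left)
  then have "card (UNIV - {0 :: 'a}) = card (\<Union>a\<in>\<Phi>. {x. x ^ m = a})"
    by simp
  also have "\<dots> = (\<Sum>a\<in>\<Phi>. card {x. x ^ m = a})"
    by (rule card_UN_disjoint) auto
  finally have "(\<Sum>a\<in>\<Phi>. card {x. x ^ m = a}) = k * m"
    by (simp add: card_field card_Diff_singleton)
  also have "\<dots> = (\<Sum>a\<in>\<Phi>. m)"
    by (simp add: card_\<Phi>)
  \<comment> \<open>The root bound makes the truncated subtraction exact, so it commutes with the
    sum.\<close>
  finally have "(\<Sum>a\<in>\<Phi>. m - card {x. x ^ m = a}) = 0"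
    using card_nth_roots_le[OF m_gt_0] by (subst sum_subtractf_nat) auto
  then have "m - card {x. x ^ m = a} = 0"
    using assms by simp
  then show ?thesis
    using card_nth_roots_le[OF m_gt_0, of a] by simp
qed

text \<open>The multiplicity with which a value arises as an \<open>m\<close>-th power; it reduces
  counting solutions to a weighted count of triples of values.\<close>

definition weight :: "'a \<Rightarrow> nat"
  where "weight a = card {x. x ^ m = a}"

lemma weight_simps [simp]: "a \<in> \<Phi> \<Longrightarrow> weight a = m" "weight 0 = 1"
proof -
  have "{x :: 'a. x ^ m = 0} = {0}"
    using m_gt_0 by auto
  then show "weight 0 = 1"
    by (simp add: weight_def)
qed (simp add: weight_def card_power_m_fibre)

lemma card_preimage_triples:
  "card {(x, y, z). (x ^ m, y ^ m, z ^ m) \<in> S} = (\<Sum>(a, b, c)\<in>S. weight a * weight b * weight c)"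
proof -
  let ?F = "\<lambda>(a, b, c). {x. x ^ m = a} \<times> {y. y ^ m = b} \<times> {z. z ^ m = c}"
  have "{(x, y, z). (x ^ m, y ^ m, z ^ m) \<in> S} = (\<Union>t\<in>S. ?F t)"
    by auto
  moreover have "card (\<Union>t\<in>S. ?F t) = (\<Sum>t\<in>S. card (?F t))"
    by (rule card_UN_disjoint) auto
  ultimately have "card {(x, y, z). (x ^ m, y ^ m, z ^ m) \<in> S} = (\<Sum>t\<in>S. card (?F t))"
    by simp
  also have "\<dots> = (\<Sum>(a, b, c)\<in>S. weight a * weight b * weight c)"
    by (intro sum.cong) (auto simp: card_cartesian_product weight_def)
  finally show ?thesis .
qed

section \<open>The equation \<open>a + b - c = 1\<close> inside \<open>\<Phi>\<close>\<close>

definition \<Phi>_triples :: "('a \<times> 'a \<times> 'a) set"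
  where "\<Phi>_triples = {(a, b, c). a \<in> \<Phi> \<and> b \<in> \<Phi> \<and> c \<in> \<Phi> \<and> a + b - c = 1}"

definition unit_sums :: "'a set"
  where "unit_sums = {a \<in> \<Phi>. 1 - a \<in> \<Phi>}"

text \<open>If \<open>a + b \<noteq> 0\<close>, uniqueness of sums matches \<open>a\<close>,
  \<open>b\<close> with 1, \<open>c\<close> and gives the first two families;
  \<open>a + b = 0\<close> forces \<open>c = -1\<close>, the third.\<close>

lemma \<Phi>_triples_eq:
  "\<Phi>_triples = (\<lambda>b. (1, b, b)) ` \<Phi> \<union> (\<lambda>a. (a, 1, a)) ` \<Phi> \<union>
     (if -1 \<in> \<Phi> then (\<lambda>a. (a, - a, -1)) ` \<Phi> else {})"
    (is "_ = ?R")
proof (intro Set.set_eqI iffI)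
  fix t assume "t \<in> \<Phi>_triples"
  then obtain a b c where t: "t = (a, b, c)" "a \<in> \<Phi>" "b \<in> \<Phi>" "c \<in> \<Phi>" "a + b - c = 1"
    by (auto simp: \<Phi>_triples_def)
  then have eq: "a + b = 1 + c"
    by (simp add: algebra_simps)
  show "t \<in> ?R"
  proof (cases "a + b = 0")
    case True
    then have "c = -1" "b = - a"
      using eq by (simp_all add: eq_neg_iff_add_eq_0 add.commute)
    then show ?thesis
      using t by auto
  next
    case False
    then show ?thesis
      using circular_sum_unique[OF circ t(2,3) one_in t(4) eq] t by auto
  qed
next
  fix t assume "t \<in> ?R"
  then consider b where "t = (1, b, b)" "b \<in> \<Phi>" | a where "t = (a, 1, a)" "a \<in> \<Phi>"
    | a where "t = (a, - a, -1)" "a \<in> \<Phi>" "-1 \<in> \<Phi>"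
    by (auto split: if_splits)
  then show "t \<in> \<Phi>_triples"
  proof cases
    case 3
    then show ?thesis
      using uminus_in[of "fst t"] by (simp add: \<Phi>_triples_def)
  qed (use one_in in \<open>simp_all add: \<Phi>_triples_def\<close>)
qed

text \<open>Inclusion-exclusion on three families of size \<open>k\<close>. The first two share
  \<open>(1, 1, 1)\<close>; the third meets their union in two triples, which coincide in
  characteristic 2.\<close>

lemma card_\<Phi>_triples:
  "card \<Phi>_triples =
     (if (2 :: 'a) = 0 then 3 * k - 2 else if even k then 3 * (k - 1) else 2 * k - 1)"
proof -
  let ?A = "(\<lambda>b. (1, b, b)) ` \<Phi>" and ?B = "(\<lambda>a. (a, 1, a)) ` \<Phi>"
    and ?C = "(\<lambda>a. (a, - a, -1)) ` \<Phi>"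
  have A: "card ?A = k" and B: "card ?B = k" and C: "card ?C = k"
    by (subst card_image; simp add: inj_on_def card_\<Phi>)+
  have "?A \<inter> ?B = {(1, 1, 1)}"
    using one_in by auto
  then have AB: "card (?A \<union> ?B) = 2 * k - 1"
    using card_Un_Int[of ?A ?B] unfolding A B by simp
  show ?thesis
  proof (cases "-1 \<in> \<Phi>")
    case False
    then show ?thesis
      using AB minus_one_in_iff by (simp add: \<Phi>_triples_eq)
  next
    case True
    have "(?A \<union> ?B) \<inter> ?C = {(1, -1, -1), (-1, 1, -1)}"
      using one_in True by auto
    moreover have "(1 :: 'a) = -1 \<longleftrightarrow> (2 :: 'a) = 0"
      by (metis add.right_inverse one_add_one eq_neg_iff_add_eq_0)
    ultimately have "card ((?A \<union> ?B) \<inter> ?C) = (if (2 :: 'a) = 0 then 1 else 2)"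
      by (auto simp: card_insert_if)
    then have "card (?A \<union> ?B \<union> ?C) = (if (2 :: 'a) = 0 then 3 * k - 2 else 3 * (k - 1))"
      using card_Un_Int[of "?A \<union> ?B" ?C] k_gt_0 unfolding AB C by auto
    then show ?thesis
      using True minus_one_in_iff by (auto simp: \<Phi>_triples_eq)
  qed
qed

section \<open>The equation \<open>a + b = 1\<close> inside \<open>\<Phi>\<close>\<close>

lemma unit_sums_quadratic:
  assumes "-1 \<in> \<Phi>" "a \<in> \<Phi>" "1 - a \<in> \<Phi>"
  shows "a * a - a + 1 = 0"
proof -
  have *: "x = -1 \<or> x * x - x + 1 = 0" if x: "x \<in> \<Phi>" "1 - x \<in> \<Phi>" for x
  proof -
    have "x * x + x * (1 - x) = 1 + - (1 - x)"
      by (simp add: algebra_simps)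
    moreover have "x * x + x * (1 - x) \<noteq> 0"
      using x zero_notin by (auto simp: algebra_simps)
    \<comment> \<open>Both sums equal \<open>x\<close>. The second matching is the quadratic
      equation; the first leaves the exceptional value -1.\<close>
    ultimately have "x * x = 1 \<and> x * (1 - x) = - (1 - x) \<or> x * x = - (1 - x) \<and> x * (1 - x) = 1"
      by (rule circular_sum_unique[OF circ mult_in[OF x(1) x(1)] mult_in[OF x] one_in
            uminus_in[OF assms(1) x(2)]])
    moreover have "x = -1" if "x * (1 - x) = - (1 - x)"
    proof -
      have "(x + 1) * (1 - x) = 0"
        using that by (simp add: algebra_simps)
      then show ?thesis
        using x zero_notin by (auto simp: eq_neg_iff_add_eq_0)
    qed
    ultimately show ?thesis
      by (auto simp: algebra_simps)
  qed
  \<comment> \<open>The quadratic is invariant under \<open>a \<mapsto> 1 - a\<close>, so the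
    exception survives only if \<open>a\<close> and \<open>1 - a\<close> are both -1; then
    \<open>a * a + (1 - a) = 0\<close> anyway.\<close>
  have "1 - (1 - a) \<in> \<Phi>"
    using assms by simp
  then have "1 - a = -1 \<or> (1 - a) * (1 - a) - (1 - a) + 1 = 0"
    using *[of "1 - a"] assms by blast
  moreover have "a = -1 \<or> a * a - a + 1 = 0"
    using * assms by blast
  moreover have "(1 - a) * (1 - a) - (1 - a) + 1 = a * a - a + 1"
    by (simp add: algebra_simps)
  ultimately show ?thesis
    by auto
qed

lemma unit_sums_half:
  assumes "-1 \<notin> \<Phi>" "a \<in> \<Phi>" "1 - a \<in> \<Phi>"
  shows "2 * a = 1"
proof -
  let ?b = "1 - a"
  \<comment> \<open>Otherwise \<open>a\<close> would be a root of \<open>a * a - a + 1\<close>, so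
    its cube -1 would lie in \<open>\<Phi>\<close>.\<close>
  have "a * a + ?b \<noteq> 0"
  proof
    assume "a * a + ?b = 0"
    moreover have "a * a * a + 1 = (a + 1) * (a * a + ?b)"
      by (simp add: algebra_simps)
    ultimately have "a * a * a = -1"
      by (simp add: eq_neg_iff_add_eq_0)
    then show False
      using assms mult_in by metis
  qed
  moreover have "a * a + ?b = a + ?b * ?b"
    by (simp add: algebra_simps)
  ultimately have "a * a = a \<and> ?b = ?b * ?b \<or> a * a = ?b * ?b \<and> ?b = a"
    by (intro circular_sum_unique[OF circ] mult_in assms)
  moreover have "a \<noteq> 0" "a \<noteq> 1"
    using assms zero_notin by auto
  ultimately show ?thesis
    by (auto simp: algebra_simps)
qed

lemma card_unit_sums_no_minus_one:
  assumes "-1 \<notin> \<Phi>"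
  shows "card unit_sums = (if 2 \<in> \<Phi> then 1 else 0)"
proof -
  have two: "(2 :: 'a) \<noteq> 0"
    using assms minus_one_in_iff by auto
  have half: "a = 1 / 2" if "a \<in> unit_sums" for a
    using that unit_sums_half[OF assms, of a] two by (auto simp: unit_sums_def field_simps)
  have "unit_sums = (if 2 \<in> \<Phi> then {1 / 2} else {})"
  proof (cases "2 \<in> \<Phi>")
    case True
    have "1 - 1 / 2 = (1 / 2 :: 'a)"
      using two by (simp add: field_simps)
    then have "1 / 2 \<in> unit_sums"
      using divide_in[OF one_in True] unfolding unit_sums_def mem_Collect_eq by argo
    then show ?thesis
      using half True by auto
  next
    case False
    have "unit_sums = {}"
    proof (rule equals0I)
      fix a assume "a \<in> unit_sums"
      then have "1 / 2 \<in> \<Phi>"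
        using half[of a] by (simp only: unit_sums_def mem_Collect_eq)
      then have "2 \<in> \<Phi>"
        using divide_in[OF one_in, of "1 / 2"] by simp
      then show False
        using False by simp
    qed
    then show ?thesis
      using False by simp
  qed
  then show ?thesis
    by simp
qed

text \<open>Outside characteristic 3 the roots of \<open>w * w + w + 1\<close> are the elements of
  order 3. Their negatives are the roots of the quadratic satisfied by
  \<open>unit_sums\<close>.\<close>

lemma three_dvd_iff:
  assumes "(3 :: 'a) \<noteq> 0"
  shows "3 dvd k \<longleftrightarrow> (\<exists>w. w * w + w + 1 = 0 \<and> w \<in> \<Phi>)"
proof
  assume "3 dvd k"
  then obtain j where j: "k = 3 * j"
    by auto
  \<comment> \<open>Only \<open>j < k\<close> elements can satisfy \<open>x ^ j = 1\<close>; for any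
    other \<open>x\<close> in \<open>\<Phi>\<close>, \<open>x ^ j\<close> has order 3.\<close>
  have "\<exists>x\<in>\<Phi>. x ^ j \<noteq> 1"
  proof (rule ccontr)
    assume "\<not> ?thesis"
    then have "card \<Phi> \<le> card {x :: 'a. x ^ j = 1}"
      by (intro card_mono) auto
    then show False
      using card_nth_roots_le[of j "1 :: 'a"] j k_gt_0 card_\<Phi> by simp
  qed
  then obtain x where x: "x \<in> \<Phi>" "x ^ j \<noteq> 1"
    by auto
  define w where "w = x ^ j"
  have "w ^ 3 = x ^ k"
    by (simp add: w_def j mult.commute flip: power_mult)
  then have w3: "w ^ 3 = 1"
    using x by (simp add: \<Phi>_eq)
  then have "(w - 1) * (w * w + w + 1) = 0"
    by (simp add: algebra_simps power3_eq_cube)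
  then have "w * w + w + 1 = 0"
    using x by (simp add: w_def)
  moreover have "w \<in> \<Phi>"
    using w3 by (simp add: \<Phi>_eq j power_mult)
  ultimately show "\<exists>w. w * w + w + 1 = 0 \<and> w \<in> \<Phi>"
    by blast
next
  assume "\<exists>w. w * w + w + 1 = 0 \<and> w \<in> \<Phi>"
  then obtain w where w: "w * w + w + 1 = 0" "w \<in> \<Phi>"
    by auto
  have "w ^ 3 - 1 = (w - 1) * (w * w + w + 1)"
    by (simp add: algebra_simps power3_eq_cube)
  then have w3: "w ^ 3 = 1"
    using w by simp
  have w1: "w \<noteq> 1"
    using w assms by auto
  have "w ^ (3 * (k div 3) + k mod 3) = 1"
    using w by (simp add: \<Phi>_eq)
  then have "w ^ (k mod 3) = 1"
    unfolding power_add power_mult w3 by simp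
  moreover have "k mod 3 = 0 \<or> k mod 3 = 1 \<or> k mod 3 = 2"
    by arith
  moreover have "w ^ 2 \<noteq> 1"
    using w3 w1 by (auto simp: power3_eq_cube power2_eq_square)
  ultimately have "k mod 3 = 0"
    using w1 by auto
  then show "3 dvd k"
    by auto
qed

lemma card_unit_sums_minus_one:
  assumes "-1 \<in> \<Phi>"
  shows "card unit_sums = (if (3 :: 'a) = 0 then 1 else if 3 dvd k then 2 else 0)"
proof (cases "(3 :: 'a) = 0")
  case True
  \<comment> \<open>In characteristic 3 the quadratic has the double root -1.\<close>
  have sq: "a * a - a + 1 = (a + 1) * (a + 1)" for a :: 'a
  proof -
    have "(a + 1) * (a + 1) = a * a - a + 1 + 3 * a"
      by (simp add: ring_distribs)
    then show ?thesis
      using True by (simp only: mult_zero_left add_0_right)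
  qed
  have "a = -1" if "a \<in> unit_sums" for a
  proof -
    have "(a + 1) * (a + 1) = 0"
      using unit_sums_quadratic[OF assms, of a] that sq[of a] by (simp add: unit_sums_def)
    then show ?thesis
      by (simp add: eq_neg_iff_add_eq_0)
  qed
  moreover have "1 - (-1) = (-1 :: 'a)"
    using True by (simp add: eq_neg_iff_add_eq_0)
  then have "-1 \<in> unit_sums"
    using assms by (simp only: unit_sums_def mem_Collect_eq)
  ultimately have "unit_sums = {-1}"
    by blast
  then show ?thesis
    using True by simp
next
  case False
  have quad: "a * a - a + 1 = 0" if "a \<in> unit_sums" for a
    using unit_sums_quadratic[OF assms, of a] that by (auto simp: unit_sums_def)
  show ?thesis
  proof (cases "3 dvd k")
    case True
    then obtain w where w: "w * w + w + 1 = 0" "w \<in> \<Phi>"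
      using three_dvd_iff[OF False] by auto
    \<comment> \<open>The two roots are \<open>- w\<close> and \<open>- (w * w)\<close>, the latter
      written as \<open>1 + w\<close>; they sum to 1.\<close>
    have fac: "a * a - a + 1 = (a + w) * (a - (1 + w)) + (w * w + w + 1)" for a
      by (simp add: algebra_simps)
    have w1: "1 + w = - (w * w)"
      using w(1) by (simp only: eq_neg_iff_add_eq_0 ac_simps)
    have "1 + w \<in> \<Phi>"
      unfolding w1 using uminus_in[OF assms mult_in[OF w(2) w(2)]] .
    then have "{- w, 1 + w} \<subseteq> unit_sums"
      using uminus_in[OF assms w(2)] by (simp add: unit_sums_def)
    moreover have "unit_sums \<subseteq> {- w, 1 + w}"
    proof
      fix a assume "a \<in> unit_sums"
      then have "(a + w) * (a - (1 + w)) = 0"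
        using quad[of a] unfolding fac w(1) by (simp only: add_0_right)
      then show "a \<in> {- w, 1 + w}"
        by (auto simp: eq_neg_iff_add_eq_0)
    qed
    ultimately have "unit_sums = {- w, 1 + w}"
      by blast
    moreover have "- w \<noteq> 1 + w"
    proof
      assume *: "- w = 1 + w"
      have "2 * w + 1 = (1 + w) - (- w)"
        by simp
      also have "\<dots> = 0"
        using * by (simp only: right_minus_eq)
      finally have 2: "2 * w + 1 = 0" .
      \<comment> \<open>Completing the square exhibits the discriminant -3, so a double root would
        force 3 = 0.\<close>
      have "3 = 4 * (w * w + w + 1) - (2 * w + 1) * (2 * w + 1)"
        by (simp add: algebra_simps)
      also have "\<dots> = 0"
        unfolding w(1) 2 by simp
      finally show False
        using False by simp
    qed
    ultimately show ?thesis
      using True False by simp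
  next
    case nd: False
    have "unit_sums = {}"
    proof (rule equals0I)
      fix a assume a: "a \<in> unit_sums"
      then have "- a \<in> \<Phi>" "(- a) * (- a) + (- a) + 1 = 0"
        using quad[OF a] uminus_in[OF assms, of a] by (simp_all add: unit_sums_def)
      then show False
        using nd three_dvd_iff[OF False] by blast
    qed
    then show ?thesis
      using nd False by simp
  qed
qed

section \<open>Weighted counting of solutions over the whole field\<close>

lemma card_nonzero_solutions:
  "card {(x :: 'a, y, z). x ^ m + y ^ m - z ^ m = 1 \<and> x * y * z \<noteq> 0} = card \<Phi>_triples * m ^ 3"
proof -
  have "{(x :: 'a, y, z). x ^ m + y ^ m - z ^ m = 1 \<and> x * y * z \<noteq> 0} =
      {(x, y, z). (x ^ m, y ^ m, z ^ m) \<in> \<Phi>_triples}"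
    using power_m_in zero_notin m_gt_0 by (auto simp: \<Phi>_triples_def power_0_left)
  then have "card {(x :: 'a, y, z). x ^ m + y ^ m - z ^ m = 1 \<and> x * y * z \<noteq> 0} =
      (\<Sum>(a, b, c)\<in>\<Phi>_triples. weight a * weight b * weight c)"
    by (simp add: card_preimage_triples)
  also have "\<dots> = (\<Sum>t\<in>\<Phi>_triples. m ^ 3)"
    by (intro sum.cong) (auto simp: \<Phi>_triples_def power3_eq_cube)
  finally show ?thesis
    by simp
qed

text \<open>
  The solutions with exactly one zero coordinate are all governed by \<^const>\<open>unit_sums\<close>:
  dividing \<open>a + b = 1\<close> by \<open>a\<close> turns it into \<open>1 / a - b / a = 1\<close>.
\<close>

lemma card_solutions:
  "card {(x :: 'a, y, z). x ^ m + y ^ m - z ^ m = 1} =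
     card \<Phi>_triples * m ^ 3 + 3 * card unit_sums * m ^ 2 + (if -1 \<in> \<Phi> then 3 else 2) * m"
proof -
  let ?w = "\<lambda>(a, b, c). weight a * weight b * weight c"
  \<comment> \<open>\<open>?X\<close>, \<open>?Y\<close>, \<open>?Z\<close> have their only zero in
    the first, second, third coordinate; \<open>?E\<close> holds the triples with two zeros.\<close>
  let ?X = "(\<lambda>a. (0, 1 / a, (1 - a) / a)) ` unit_sums"
  let ?Y = "(\<lambda>a. (1 / a, 0, (1 - a) / a)) ` unit_sums"
  let ?Z = "(\<lambda>a. (a, 1 - a, 0)) ` unit_sums"
  let ?E = "(if -1 \<in> \<Phi> then {(0, 0, -1)} else {}) \<union> {(1, 0, 0), (0, 1, 0)} :: ('a \<times> 'a \<times> 'a) set"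
  let ?S = "{(a, b, c). a \<in> insert 0 \<Phi> \<and> b \<in> insert 0 \<Phi> \<and> c \<in> insert 0 \<Phi> \<and> a + b - c = 1}"
  have diff: "(b, c) \<in> (\<lambda>a. (1 / a, (1 - a) / a)) ` unit_sums"
    if "b \<in> \<Phi>" "c \<in> \<Phi>" "b - c = 1" for b c
  proof (rule image_eqI)
    have b: "b \<noteq> 0"
      using that zero_notin by auto
    have c: "1 - 1 / b = c / b"
      using that b by (simp add: field_simps)
    show "(b, c) = (1 / (1 / b), (1 - 1 / b) / (1 / b))"
      unfolding c using b by simp
    show "1 / b \<in> unit_sums"
      using that c by (auto simp: unit_sums_def intro: divide_in one_in)
  qed
  have unit_sumsD: "1 / a \<in> \<Phi>" "(1 - a) / a \<in> \<Phi>" "1 / a - (1 - a) / a = 1" if "a \<in> unit_sums" for a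
  proof -
    have "a \<in> \<Phi>" "1 - a \<in> \<Phi>" "a \<noteq> 0"
      using that zero_notin by (auto simp: unit_sums_def)
    then show "1 / a \<in> \<Phi>" "(1 - a) / a \<in> \<Phi>" "1 / a - (1 - a) / a = 1"
      by (simp_all add: divide_in one_in flip: diff_divide_distrib)
  qed
  have "{(x :: 'a, y, z). x ^ m + y ^ m - z ^ m = 1} = {(x, y, z). (x ^ m, y ^ m, z ^ m) \<in> ?S}"
    using power_m_in m_gt_0 by (auto simp: power_0_left)
  then have "card {(x :: 'a, y, z). x ^ m + y ^ m - z ^ m = 1} = sum ?w ?S"
    by (simp only: card_preimage_triples)
  also have "?S = \<Phi>_triples \<union> (?X \<union> (?Y \<union> (?Z \<union> ?E)))"
  proof (intro Set.set_eqI iffI)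
    fix t assume "t \<in> ?S"
    then obtain a b c where t: "t = (a, b, c)" "a \<in> insert 0 \<Phi>" "b \<in> insert 0 \<Phi>"
      "c \<in> insert 0 \<Phi>" "a + b - c = 1"
      by auto
    consider "a = 0" "b = 0" | "a = 0" "b \<in> \<Phi>" "c = 0" | "a = 0" "b \<in> \<Phi>" "c \<in> \<Phi>"
      | "a \<in> \<Phi>" "b = 0" "c = 0" | "a \<in> \<Phi>" "b = 0" "c \<in> \<Phi>"
      | "a \<in> \<Phi>" "b \<in> \<Phi>" "c = 0" | "a \<in> \<Phi>" "b \<in> \<Phi>" "c \<in> \<Phi>"
      using t by auto
    then show "t \<in> \<Phi>_triples \<union> (?X \<union> (?Y \<union> (?Z \<union> ?E)))"
    proof cases
      case 1
      then have "c = -1"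
        using t by (simp add: minus_equation_iff)
      then show ?thesis
        using 1 t by auto
    next
      case 3
      then show ?thesis
        using diff[of b c] t by auto
    next
      case 5
      then show ?thesis
        using diff[of a c] t by auto
    next
      case 6
      then have "b = 1 - a"
        using t by (simp add: algebra_simps)
      then show ?thesis
        using 6 t by (auto simp: unit_sums_def)
    qed (use t in \<open>auto simp: \<Phi>_triples_def\<close>)
  next
    fix t assume "t \<in> \<Phi>_triples \<union> (?X \<union> (?Y \<union> (?Z \<union> ?E)))"
    then consider "t \<in> \<Phi>_triples" | "t \<in> ?X" | "t \<in> ?Y" | "t \<in> ?Z" | "t \<in> ?E"
      by blast
    then show "t \<in> ?S"
    proof cases
      case 2
      then obtain a where "t = (0, 1 / a, (1 - a) / a)" "a \<in> unit_sums"
        by blast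
      then show ?thesis
        using unit_sumsD[of a] by simp
    next
      case 3
      then obtain a where "t = (1 / a, 0, (1 - a) / a)" "a \<in> unit_sums"
        by blast
      then show ?thesis
        using unit_sumsD[of a] by simp
    next
      case 5
      then show ?thesis
        using one_in by (auto split: if_splits)
    qed (auto simp: \<Phi>_triples_def unit_sums_def)
  qed
  also have "sum ?w \<dots> = sum ?w \<Phi>_triples + (sum ?w ?X + (sum ?w ?Y + (sum ?w ?Z + sum ?w ?E)))"
  proof -
    have ne: "a \<noteq> 0" "1 - a \<noteq> 0" "a \<in> \<Phi>" "1 - a \<in> \<Phi>" if "a \<in> unit_sums" for a
      using that zero_notin by (auto simp: unit_sums_def)
    \<comment> \<open>The positions of the zero coordinates tell the pieces apart.\<close>
    have "?Z \<inter> ?E = {}" "?Y \<inter> (?Z \<union> ?E) = {}" "?X \<inter> (?Y \<union> (?Z \<union> ?E)) = {}"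
      "\<Phi>_triples \<inter> (?X \<union> (?Y \<union> (?Z \<union> ?E))) = {}"
      using ne zero_notin by (fastforce simp: \<Phi>_triples_def split: if_splits)+
    then show ?thesis
      by (simp only: sum.union_disjoint finite)
  qed
  \<comment> \<open>A nonzero coordinate contributes a factor \<open>m\<close>, a zero one the
    factor 1.\<close>
  also have "sum ?w \<Phi>_triples = (\<Sum>t\<in>\<Phi>_triples. m ^ 3)"
    by (intro sum.cong) (auto simp: \<Phi>_triples_def power3_eq_cube)
  also have "sum ?w ?X = (\<Sum>a\<in>unit_sums. m ^ 2)"
    using unit_sumsD by (subst sum.reindex) (auto simp: inj_on_def power2_eq_square intro!: sum.cong)
  also have "sum ?w ?Y = (\<Sum>a\<in>unit_sums. m ^ 2)"
    using unit_sumsD by (subst sum.reindex) (auto simp: inj_on_def power2_eq_square intro!: sum.cong)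
  also have "sum ?w ?Z = (\<Sum>a\<in>unit_sums. m ^ 2)"
    by (subst sum.reindex) (auto simp: inj_on_def power2_eq_square unit_sums_def intro!: sum.cong)
  also have "sum ?w ?E = (if -1 \<in> \<Phi> then 3 else 2) * m"
    using one_in by auto
  finally show ?thesis
    by (simp add: algebra_simps)
qed

end

theorem theorem1:
  fixes \<Phi> :: "'a::{finite,field} set"
    and p r q k m N N' :: nat
  assumes "Factorial_Ring.prime p"
    and "q = p ^ r"
    and "card (UNIV :: 'a set) = q"
    and "k \<ge> 3"
    and "k dvd q - 1"
    and "m = (q - 1) div k"
    and "subgroup \<Phi> mult_group"
    and "card \<Phi> = k"
    and "circular \<Phi>"
    and "N = card {(x :: 'a, y :: 'a, z :: 'a). x ^ m + y ^ m - z ^ m = 1}"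
    and "N' = card {(x :: 'a, y :: 'a, z :: 'a).
                      x ^ m + y ^ m - z ^ m = 1 \<and> x * y * z \<noteq> 0}"
  shows "(even k \<longrightarrow>
            N = (if 6 dvd k then 3 * (k - 1) * m ^ 3 + 6 * m ^ 2 + 3 * m
                 else if p = 3 then 3 * (k - 1) * m ^ 3 + 3 * m ^ 2 + 3 * m
                 else 3 * (k - 1) * m ^ 3 + 3 * m) \<and>
            N' = 3 * (k - 1) * m ^ 3) \<and>
         (odd k \<longrightarrow>
            N = (if p = 2 \<and> 3 dvd k then (3 * k - 2) * m ^ 3 + 6 * m ^ 2 + 3 * m
                 else if p = 2 \<and> \<not> 3 dvd k then (3 * k - 2) * m ^ 3 + 3 * m
                 else if 2 \<in> \<Phi> then (2 * k - 1) * m ^ 3 + 3 * m ^ 2 + 2 * m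
                 else (2 * k - 1) * m ^ 3 + 2 * m) \<and>
            N' = (if p = 2 then (3 * k - 2) * m ^ 3 else (2 * k - 1) * m ^ 3))"
proof -
  have q1: "q > 1"
    using assms(3) card_mono[of UNIV "{0, 1 :: 'a}"] by simp
  have km: "k * m = q - 1"
    using assms(5,6) by simp
  then have m: "m > 0"
    using q1 by (cases m) auto
  have sub: "\<Phi> \<subseteq> UNIV - {0}" and mult: "\<And>x y. x \<in> \<Phi> \<Longrightarrow> y \<in> \<Phi> \<Longrightarrow> x * y \<in> \<Phi>"
    using subgroup.subset[OF assms(7)] subgroup.m_closed[OF assms(7)]
    by (auto simp: ring_of_type_algebra_def)
  \<comment> \<open>\<open>\<Phi>\<close> has \<open>k\<close> elements, all among the at most
    \<open>k\<close> roots of \<open>x ^ k = 1\<close>, so it exhausts them.\<close>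
  have "\<Phi> \<subseteq> {x. x ^ k = 1}"
    using power_card_eq_1[of \<Phi>] sub mult assms(8) by auto
  moreover have "card {x :: 'a. x ^ k = 1} \<le> card \<Phi>"
    using card_nth_roots_le[of k "1 :: 'a"] assms(4,8) by simp
  ultimately have "\<Phi> = {x. x ^ k = 1}"
    by (intro card_seteq) auto
  then interpret circular_roots \<Phi> k m
    using assms m q1 km by unfold_locales auto
  have "of_nat p ^ r = (0 :: 'a)"
    using of_nat_card_UNIV_eq_0 assms(2,3) by (metis of_nat_power)
  then have p0: "of_nat p = (0 :: 'a)" and r: "r \<noteq> 0"
    by (auto simp: power_0_left)
  have two: "(2 :: 'a) = 0 \<longleftrightarrow> p = 2" and three: "(3 :: 'a) = 0 \<longleftrightarrow> p = 3"
    using of_nat_prime_eq_0_iff[OF assms(1) _ p0, of 2]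
      of_nat_prime_eq_0_iff[OF assms(1) _ p0, of 3] by simp_all
  \<comment> \<open>As \<open>k\<close> divides \<open>q - 1\<close>, it is prime to the
    characteristic: even \<open>k\<close> excludes \<open>p = 2\<close>, and \<open>3 dvd k\<close>
    excludes \<open>p = 3\<close>, so the listed cases do not clash.\<close>
  have "\<not> p dvd k"
  proof
    assume "p dvd k"
    then have "p dvd q - 1" "p dvd q"
      using assms(2,5) r by (auto intro: dvd_trans)
    then have "p dvd 1"
      using q1 by (metis dvd_diffD1 less_imp_le)
    then show False
      using assms(1) by simp
  qed
  then have even: "even k \<Longrightarrow> p \<noteq> 2" "p = 3 \<Longrightarrow> \<not> 3 dvd k"
    by auto
  have six: "6 dvd k \<longleftrightarrow> 3 dvd k" if "even k"
    using that by presburger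
  show ?thesis
    unfolding assms(10,11) card_solutions card_nonzero_solutions card_\<Phi>_triples
    using even six minus_one_in_iff two three card_unit_sums_minus_one card_unit_sums_no_minus_one
    by auto
qed

end
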